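(* Let $G$ be a finite set of finite sets and let $h: G\to\mathbb{R}$ be any function. Then the matrices $L=L^{--}$ and $g=SL^{++}S$ satisfy $$\det(L)=\det(g)=\prod_{x\in G}h(x).$$
   Context: For $x\in G$ let $W^+(x)=\{y\in G: x\subset y\}$ and $W^-(x)=\{y\in G: y\subset x\}$ (both include $x$). Let $|x|$ be the cardinality of $x$, $\dim(x)=|x|-1$ and $\omega(x)=(-1)^{\dim(x)}$. For a function $h$ on $G$ and $A\subset G$ put $E[A]=\sum_{x\in A}h(x)$ (with $E[\emptyset]=0$). The matrices, indexed by $G\times G$, are $L^{--}(x,y)=E[W^-(x)\cap W^-(y)]$, $L^{++}(x,y)=E[W^+(x)\cap W^+(y)]$, and $S(x,y)=\omega(x)$ if $x=y$ and $0$ otherwise. Set $L=L^{--}$ and $g=SL^{++}S$. No closure property of $G$ under subsets is assumed. *)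

theory Defs
  imports "Jordan_Normal_Form.Determinant"
begin

definition W_plus :: "'a set set \<Rightarrow> 'a set \<Rightarrow> 'a set set" where
  "W_plus G x = {y \<in> G. x \<subseteq> y}"

definition W_minus :: "'a set set \<Rightarrow> 'a set \<Rightarrow> 'a set set" where
  "W_minus G x = {y \<in> G. y \<subseteq> x}"

(* Integer-valued: the empty set may belong to G, and it has dimension -1. *)
definition set_dim :: "'a set \<Rightarrow> int" where
  "set_dim x = int (card x) - 1"

definition omega :: "'a set \<Rightarrow> real" where
  "omega x = (-1) powi (set_dim x)"

definition energy :: "('a set \<Rightarrow> real) \<Rightarrow> 'a set set \<Rightarrow> real" where
  "energy h A = (\<Sum>x\<in>A. h x)"

(* Library matrices are indexed by initial segments of nat, so a matrix indexed by G x G is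
   written down along a list xs that enumerates G without repetition: row i and column i
   belong to the set xs ! i. *)
definition indexed_mat :: "'a set list \<Rightarrow> ('a set \<Rightarrow> 'a set \<Rightarrow> real) \<Rightarrow> real mat" where
  "indexed_mat xs M = mat (length xs) (length xs) (\<lambda>(i, j). M (xs ! i) (xs ! j))"

definition L_minus_minus :: "('a set \<Rightarrow> real) \<Rightarrow> 'a set list \<Rightarrow> real mat" where
  "L_minus_minus h xs =
     indexed_mat xs (\<lambda>x y. energy h (W_minus (set xs) x \<inter> W_minus (set xs) y))"

definition L_plus_plus :: "('a set \<Rightarrow> real) \<Rightarrow> 'a set list \<Rightarrow> real mat" where
  "L_plus_plus h xs =
     indexed_mat xs (\<lambda>x y. energy h (W_plus (set xs) x \<inter> W_plus (set xs) y))"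

definition S_mat :: "'a set list \<Rightarrow> real mat" where
  "S_mat xs = indexed_mat xs (\<lambda>x y. if x = y then omega x else 0)"

definition g_mat :: "('a set \<Rightarrow> real) \<Rightarrow> 'a set list \<Rightarrow> real mat" where
  "g_mat h xs = S_mat xs * L_plus_plus h xs * S_mat xs"

end

theory Submission
  imports Defs
begin

text \<open>
  The energy of an intersection of lower sets is a weighted count of common lower bounds,
  \<open>E[W\<^sup>-(x) \<inter> W\<^sup>-(y)] = (\<Sum>z\<in>G. [z \<subseteq> x] h(z) [z \<subseteq> y])\<close>. With the zeta matrix
  \<open>Z(x,y) = [y \<subseteq> x]\<close> of the poset \<open>G\<close> and the diagonal matrix \<open>D\<close> of the values of \<open>h\<close>, this
  says \<open>L\<^sup>-\<^sup>- = Z D Z\<^sup>T\<close>; counting common upper bounds gives \<open>L\<^sup>+\<^sup>+ = Z\<^sup>T D Z\<close> in the same way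
  (see \<open>L_minus_minus_factorization\<close>, \<open>L_plus_plus_factorization\<close>). So both determinants equal
  \<open>det(Z)\<^sup>2 \<Prod> h\<close>, and multiplying by \<open>S\<close> from both sides does not affect the determinant
  because the diagonal entries of \<open>S\<close> are \<open>\<plusminus>1\<close>.

  It remains to see that \<open>det Z = 1\<close>. Along an order of \<open>G\<close> that refines inclusion, \<open>Z\<close> is
  unitriangular, but the enumeration of \<open>G\<close> is arbitrary here. Instead of reordering it, the
  proof reads the determinant off the Leibniz formula: a permutation of \<open>G\<close> that sends every
  set to one of its subsets cannot change any cardinality, so it is the identity
  (\<open>permutation_of_indices_decreasing_id\<close>), and the identity contributes 1.
\<close>

section \<open>Matrices indexed by an enumerated family\<close>

lemma indexed_mat_carrier [simp]: "indexed_mat xs M \<in> carrier_mat (length xs) (length xs)"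
  by (simp add: indexed_mat_def)

lemma transpose_indexed_mat: "transpose_mat (indexed_mat xs M) = indexed_mat xs (\<lambda>x y. M y x)"
  by (rule eq_matI) (auto simp: indexed_mat_def)

lemma sum_over_enumeration:
  assumes "distinct xs"
  shows "(\<Sum>i = 0..<length xs. f (xs ! i)) = (\<Sum>x\<in>set xs. f x)"
  using assms
  by (metis atLeast0LessThan bij_betw_nth sum.reindex_bij_betw)

lemma prod_over_enumeration:
  assumes "distinct xs"
  shows "(\<Prod>i = 0..<length xs. f (xs ! i)) = (\<Prod>x\<in>set xs. f x)"
  using assms
  by (metis atLeast0LessThan bij_betw_nth prod.reindex_bij_betw)

lemma indexed_mat_mult:
  assumes "distinct xs"
  shows "indexed_mat xs M * indexed_mat xs N
       = indexed_mat xs (\<lambda>x y. \<Sum>z\<in>set xs. M x z * N z y)"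
  by (rule eq_matI)
    (auto simp: indexed_mat_def scalar_prod_def sum_over_enumeration[OF assms, symmetric])

definition diagonal_mat :: "'a set list \<Rightarrow> ('a set \<Rightarrow> real) \<Rightarrow> real mat" where
  "diagonal_mat xs d = indexed_mat xs (\<lambda>x y. if x = y then d x else 0)"

lemma det_diagonal_mat:
  assumes "distinct xs"
  shows "det (diagonal_mat xs d) = (\<Prod>x\<in>set xs. d x)"
proof -
  have "upper_triangular (diagonal_mat xs d)"
    using assms by (auto simp: diagonal_mat_def indexed_mat_def nth_eq_iff_index_eq)
  then have "det (diagonal_mat xs d) = prod_list (diag_mat (diagonal_mat xs d))"
    by (rule det_upper_triangular[where n = "length xs"]) (simp add: diagonal_mat_def)
  also have "\<dots> = (\<Prod>i = 0..<length xs. d (xs ! i))"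
    by (simp add: prod_list_diag_prod diagonal_mat_def indexed_mat_def)
  finally show ?thesis
    by (simp add: prod_over_enumeration[OF assms])
qed

section \<open>The zeta matrix of inclusion\<close>

definition zeta_mat :: "'a set list \<Rightarrow> real mat" where
  "zeta_mat xs = indexed_mat xs (\<lambda>x y. of_bool (y \<subseteq> x))"

text \<open>
  The cardinalities can only drop along \<open>p\<close>, but their total is invariant under reindexing by
  \<open>p\<close>. Hence none of them drops, and a subset of a finite set with the same cardinality is the
  whole set.
\<close>

lemma permutation_of_indices_decreasing_id:
  assumes "distinct xs" and fin: "\<And>x. x \<in> set xs \<Longrightarrow> finite x"
    and p: "p permutes {0..<length xs}"
    and sub: "\<And>i. i < length xs \<Longrightarrow> xs ! p i \<subseteq> xs ! i"
  shows "p = id"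
proof
  fix i
  have total: "(\<Sum>i = 0..<length xs. card (xs ! p i)) = (\<Sum>i = 0..<length xs. card (xs ! i))"
    using sum.permute[OF p, of "\<lambda>i. card (xs ! i)"] by (simp add: o_def)
  show "p i = id i"
  proof (cases "i < length xs")
    case True
    then have "p i < length xs"
      using permutes_in_image[OF p, of i] by simp
    have "card (xs ! p i) = card (xs ! i)"
      by (rule sum_mono_inv[OF total]) (use True sub fin in \<open>auto intro!: card_mono\<close>)
    then have "xs ! p i = xs ! i"
      using True sub fin by (intro card_subset_eq) auto
    with True \<open>p i < length xs\<close> \<open>distinct xs\<close> show ?thesis
      by (simp add: nth_eq_iff_index_eq)
  next
    case False
    with p show ?thesis
      by (simp add: permutes_not_in)
  qed
qed

lemma det_zeta_mat:
  assumes "distinct xs" and "\<And>x. x \<in> set xs \<Longrightarrow> finite x"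
  shows "det (zeta_mat xs) = 1"
proof -
  let ?n = "length xs"
  let ?term = "\<lambda>p. signof p * (\<Prod>i = 0..<?n. zeta_mat xs $$ (i, p i))"
  have "det (zeta_mat xs) = (\<Sum>p | p permutes {0..<?n}. ?term p)"
    by (rule det_def') (simp add: zeta_mat_def)
  also have "\<dots> = (\<Sum>p\<in>{id}. ?term p)"
  proof (rule sum.mono_neutral_right)
    show "\<forall>p\<in>{p. p permutes {0..<?n}} - {id}. ?term p = 0"
    proof
      fix p assume "p \<in> {p. p permutes {0..<?n}} - {id}"
      then have p: "p permutes {0..<?n}" and "p \<noteq> id" by auto
      then obtain i where i: "i < ?n" "\<not> xs ! p i \<subseteq> xs ! i"
        using permutation_of_indices_decreasing_id[OF assms] by blast
      moreover have "p i < ?n"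
        using permutes_in_image[OF p, of i] i by simp
      ultimately have "zeta_mat xs $$ (i, p i) = 0"
        by (simp add: zeta_mat_def indexed_mat_def)
      with i show "?term p = 0"
        by (auto simp: prod_zero_iff)
    qed
  qed (auto simp: finite_permutations permutes_id)
  also have "\<dots> = 1"
    by (simp add: zeta_mat_def indexed_mat_def)
  finally show ?thesis .
qed

section \<open>Factorization of the energy matrices\<close>

lemma indexed_mat_mult_diagonal:
  assumes "distinct xs"
  shows "indexed_mat xs M * diagonal_mat xs d * indexed_mat xs N
       = indexed_mat xs (\<lambda>x y. \<Sum>z\<in>set xs. M x z * d z * N z y)"
proof -
  have "indexed_mat xs M * diagonal_mat xs d
      = indexed_mat xs (\<lambda>x y. \<Sum>z\<in>set xs. M x z * (if z = y then d z else 0))"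
    by (simp add: diagonal_mat_def indexed_mat_mult[OF assms])
  also have "\<dots> = indexed_mat xs (\<lambda>x y. M x y * d y)"
    by (rule eq_matI) (auto simp: indexed_mat_def if_distrib[of "(*) _"] cong: if_cong)
  finally show ?thesis
    by (simp add: indexed_mat_mult[OF assms])
qed

lemma sum_between_indicators:
  fixes h :: "'a set \<Rightarrow> real"
  assumes "finite A"
  shows "(\<Sum>z\<in>A. of_bool (P z) * h z * of_bool (Q z)) = energy h {z \<in> A. P z \<and> Q z}"
  unfolding energy_def sum.inter_filter[OF assms] by (rule sum.cong) auto

lemma L_minus_minus_factorization:
  assumes "distinct xs"
  shows "L_minus_minus h xs = zeta_mat xs * diagonal_mat xs h * transpose_mat (zeta_mat xs)"
proof -
  have "W_minus (set xs) x \<inter> W_minus (set xs) y = {z \<in> set xs. z \<subseteq> x \<and> z \<subseteq> y}" for x y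
    by (auto simp: W_minus_def)
  then show ?thesis
    unfolding L_minus_minus_def zeta_mat_def transpose_indexed_mat
      indexed_mat_mult_diagonal[OF assms]
    by (simp only: sum_between_indicators[OF finite_set])
qed

lemma L_plus_plus_factorization:
  assumes "distinct xs"
  shows "L_plus_plus h xs = transpose_mat (zeta_mat xs) * diagonal_mat xs h * zeta_mat xs"
proof -
  have "W_plus (set xs) x \<inter> W_plus (set xs) y = {z \<in> set xs. x \<subseteq> z \<and> y \<subseteq> z}" for x y
    by (auto simp: W_plus_def)
  then show ?thesis
    unfolding L_plus_plus_def zeta_mat_def transpose_indexed_mat
      indexed_mat_mult_diagonal[OF assms]
    by (simp only: sum_between_indicators[OF finite_set])
qed

section \<open>The determinants\<close>

lemma det_mult_three:
  fixes A B C :: "real mat"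
  assumes "A \<in> carrier_mat n n" "B \<in> carrier_mat n n" "C \<in> carrier_mat n n"
  shows "det (A * B * C) = det A * det B * det C"
  using assms by (simp add: det_mult[of _ n])

lemma det_energy_matrices:
  assumes "distinct xs" and "\<And>x. x \<in> set xs \<Longrightarrow> finite x"
  shows "det (L_minus_minus h xs) = (\<Prod>x\<in>set xs. h x)"
    and "det (L_plus_plus h xs) = (\<Prod>x\<in>set xs. h x)"
proof -
  have Z: "zeta_mat xs \<in> carrier_mat (length xs) (length xs)"
    by (simp add: zeta_mat_def)
  then have ZT: "transpose_mat (zeta_mat xs) \<in> carrier_mat (length xs) (length xs)"
    by simp
  have D: "diagonal_mat xs h \<in> carrier_mat (length xs) (length xs)"
    by (simp add: diagonal_mat_def)
  have "det (zeta_mat xs) = 1" "det (transpose_mat (zeta_mat xs)) = 1"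
    using det_zeta_mat[OF assms] det_transpose[OF Z] by simp_all
  then show "det (L_minus_minus h xs) = (\<Prod>x\<in>set xs. h x)"
    and "det (L_plus_plus h xs) = (\<Prod>x\<in>set xs. h x)"
    using assms(1)
    by (simp_all add: L_minus_minus_factorization L_plus_plus_factorization
        det_mult_three[OF Z D ZT] det_mult_three[OF ZT D Z] det_diagonal_mat)
qed

lemma det_S_mat_square:
  assumes "distinct xs"
  shows "det (S_mat xs) * det (S_mat xs) = 1"
proof -
  have "omega x * omega x = 1" for x :: "'a set"
    by (simp add: omega_def flip: power_int_mult_distrib)
  moreover have "S_mat xs = diagonal_mat xs omega"
    by (simp add: S_mat_def diagonal_mat_def)
  ultimately show ?thesis
    by (simp add: det_diagonal_mat[OF assms] flip: prod.distrib)
qed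

theorem theorem3:
  fixes G :: "'a set set" and h :: "'a set \<Rightarrow> real" and xs :: "'a set list"
  assumes "finite G"
    and "\<And>x. x \<in> G \<Longrightarrow> finite x"
    and "distinct xs" and "set xs = G"
  shows "det (L_minus_minus h xs) = det (g_mat h xs) \<and>
         det (g_mat h xs) = (\<Prod>x\<in>G. h x)"
proof -
  have S: "S_mat xs \<in> carrier_mat (length xs) (length xs)"
    by (simp add: S_mat_def)
  have L: "L_plus_plus h xs \<in> carrier_mat (length xs) (length xs)"
    by (simp add: L_plus_plus_def)
  have "det (g_mat h xs) = det (S_mat xs) * det (S_mat xs) * det (L_plus_plus h xs)"
    by (simp add: g_mat_def det_mult_three[OF S L S])
  then show ?thesis
    using assms det_energy_matrices[of xs h] det_S_mat_square[of xs] by simp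
qed

end
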